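(* Let $P$ and $T$ be disjoint sets of prime numbers with $T$ finite (and $P$ finite or infinite). Then the set of all positive integers which are square-free, divisible by all the primes in $T$, and divisible by none of the primes in $P$ has a natural density, and this natural density equals $$\frac{6}{\pi^2}\prod_{p \in T}\frac{1}{1+p}\prod_{p \in P}\frac{p}{1+p}.$$
   Context: For a set $B$ of positive integers and a real number $x$, let $B[x]$ denote the number of elements $t\in B$ with $t\le x$. The natural density of $B$ (the "proportion" of positive integers lying in $B$) is $\lim_{x\to\infty} B[x]/x$, when this limit exists. Empty products equal $1$. If $P$ is infinite, the product $\prod_{p\in P}\frac{p}{1+p}$ means the limit of its partial products (which form a strictly decreasing sequence bounded below by $0$, with limit independent of the order of the factors); the value $0$ is allowed. *)

theory Defs
  imports "HOL-Analysis.Analysis" "HOL-Computational_Algebra.Squarefree"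
begin

definition count_upto :: "nat set \<Rightarrow> real \<Rightarrow> nat" where
  "count_upto B x = card {t \<in> B. real t \<le> x}"

definition has_natural_density :: "nat set \<Rightarrow> real \<Rightarrow> bool" where
  "has_natural_density B d \<longleftrightarrow> ((\<lambda>x::real. real (count_upto B x) / x) \<longlongrightarrow> d) at_top"

text \<open>
  The product of \<open>f\<close> over a possibly infinite set \<open>A\<close> of natural numbers has the value \<open>L\<close>:
  for infinite \<open>A\<close>, the partial products tend to \<open>L\<close> whatever the order of the factors.
  As every infinite set of natural numbers has an enumeration, such an \<open>L\<close> is unique.
  The library's \<open>has_prod\<close> does not fit, since it excludes partial products of nonzero
  factors that tend to \<open>0\<close>, a case that is allowed here.
\<close>

definition has_prod_over :: "(nat \<Rightarrow> real) \<Rightarrow> nat set \<Rightarrow> real \<Rightarrow> bool" where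
  "has_prod_over f A L \<longleftrightarrow>
     (if finite A then L = (\<Prod>a\<in>A. f a)
      else (\<forall>e. bij_betw e (UNIV :: nat set) A \<longrightarrow> (\<lambda>n. \<Prod>i<n. f (e i)) \<longlonglongrightarrow> L))"

end

theory Submission
  imports Defs
begin

text \<open>
  The argument rests on one principle, \<open>has_natural_density_factor\<close>: if every element of \<open>A\<close>
  is uniquely a product \<open>k b\<close> with \<open>k \<in> K\<close> and \<open>b \<in> B\<close>, if \<open>1 \<in> K\<close> and
  \<open>\<sigma> = (\<Sum>k\<in>K. 1 / k) < 2\<close>, and if \<open>A\<close> has density \<open>d\<close>, then \<open>B\<close> has density \<open>d / \<sigma>\<close>.
  The value is forced by \<open>A[x] = (\<Sum>k\<in>K. B[x / k])\<close>; the existence of the density comes from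
  a contraction, because the terms with \<open>k \<noteq> 1\<close> have total weight \<open>\<sigma> - 1 < 1\<close>.

  With the squares for \<open>K\<close> and all positive integers for \<open>A\<close>, the set \<open>B\<close> consists of the
  square-free numbers and \<open>\<sigma> = \<pi>\<^sup>2 / 6\<close>, whence their density \<open>6 / \<pi>\<^sup>2\<close>. With \<open>K = {1, p}\<close> the
  principle excludes one more prime \<open>p\<close> at the cost of a factor \<open>1 / (1 + 1 / p) = p / (1 + p)\<close>,
  and by complementation requiring \<open>p\<close> as a divisor costs a factor \<open>1 / (1 + p)\<close>. This settles
  the case of a finite \<open>P\<close> (\<open>has_natural_density_sieved_finite\<close>).

  For infinite \<open>P\<close>, excluding only the first \<open>n\<close> primes of an enumeration gives upper bounds
  for the counting function. If the infinite product is \<open>0\<close>, these bounds show that the density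
  is \<open>0\<close>. If it is positive, the sum of \<open>1 / p\<close> over \<open>P\<close> converges, and hence the multiples of
  the later primes have arbitrarily small upper density. The limit of the partial products is
  determined by the density, and so it does not depend on the enumeration.
\<close>

section \<open>Counting functions\<close>

lemma finite_below_real: "finite {t \<in> B. real t \<le> x}"
proof -
  have "{t \<in> B. real t \<le> x} \<subseteq> {..nat \<lfloor>x\<rfloor>}"
    by (auto simp: le_nat_floor)
  then show ?thesis
    using finite_subset by blast
qed

lemma count_upto_mono: "A \<subseteq> B \<Longrightarrow> count_upto A x \<le> count_upto B x"
  unfolding count_upto_def by (intro card_mono finite_below_real) auto

lemma count_upto_Diff:
  assumes "A \<subseteq> B"
  shows "real (count_upto (B - A) x) = real (count_upto B x) - real (count_upto A x)"
proof -
  have "{t \<in> B - A. real t \<le> x} = {t \<in> B. real t \<le> x} - {t \<in> A. real t \<le> x}"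
    by auto
  moreover have "card \<dots> = count_upto B x - count_upto A x"
    using assms unfolding count_upto_def
    by (intro card_Diff_subset finite_below_real) auto
  ultimately show ?thesis
    using count_upto_mono[OF assms, of x] by (simp add: count_upto_def of_nat_diff)
qed

lemma count_upto_positive: "0 \<le> x \<Longrightarrow> count_upto {0<..} x = nat \<lfloor>x\<rfloor>"
proof -
  assume "0 \<le> x"
  then have "{t \<in> {0<..}. real t \<le> x} = {0<..nat \<lfloor>x\<rfloor>}"
    by (auto simp: le_nat_floor le_floor_iff nat_le_iff) (simp add: le_nat_iff le_floor_iff)
  then show ?thesis
    by (simp add: count_upto_def)
qed

lemma count_upto_le:
  assumes "0 \<notin> B" "0 \<le> x"
  shows "real (count_upto B x) \<le> x"
proof -
  have "B \<subseteq> {0<..}"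
    using assms(1) by (auto intro: gr0I)
  then have "count_upto B x \<le> nat \<lfloor>x\<rfloor>"
    using count_upto_mono[of B "{0<..}" x] assms(2) by (simp add: count_upto_positive)
  then show ?thesis
    using assms(2) by linarith
qed

lemma count_upto_dilate:
  assumes "0 < k"
  shows "count_upto ((*) k ` B) x = count_upto B (x / real k)"
proof -
  have "{t \<in> (*) k ` B. real t \<le> x} = (*) k ` {t \<in> B. real t \<le> x / real k}"
    using assms by (auto simp: field_simps)
  then show ?thesis
    using assms by (simp add: count_upto_def card_image inj_on_def)
qed

lemma count_upto_multiples_le:
  assumes "0 < k" "0 \<le> x"
  shows "real (count_upto {t. 0 < t \<and> k dvd t} x) \<le> x / real k"
proof -
  have "{t. 0 < t \<and> k dvd t} = (*) k ` {0<..}"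
    using assms(1) by (auto elim!: dvdE)
  then show ?thesis
    using assms by (simp add: count_upto_dilate count_upto_le)
qed

text \<open>
  A product decomposition of a set turns its counting function into a sum of rescaled counting
  functions. The sum is written over all of \<open>K\<close>, so that it can be compared termwise with
  \<open>\<Sum>k\<in>K. 1 / k\<close>; its terms with \<open>k > x\<close> vanish because \<open>B\<close> has no element below \<open>1\<close>.
\<close>

lemma has_sum_count_upto_dilates:
  assumes bij: "bij_betw (\<lambda>(k, b). k * b) (K \<times> B) A" and K: "0 \<notin> K" and B: "0 \<notin> B" and x: "0 < x"
  shows "((\<lambda>k. real (count_upto B (x / real k))) has_sum real (count_upto A x)) K"
proof -
  let ?F = "{k \<in> K. real k \<le> x}"
  let ?S = "Sigma ?F (\<lambda>k. {b \<in> B. real b \<le> x / real k})"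
  have inj: "inj_on (\<lambda>(k, b). k * b) (K \<times> B)" and img: "(\<lambda>(k, b). k * b) ` (K \<times> B) = A"
    using bij by (auto simp: bij_betw_def)
  have "{a \<in> A. real a \<le> x} = (\<lambda>(k, b). k * b) ` ?S"
  proof (intro equalityI subsetI)
    fix a assume "a \<in> {a \<in> A. real a \<le> x}"
    then obtain k b where kb: "k \<in> K" "b \<in> B" "a = k * b" "real (k * b) \<le> x"
      using img by auto
    then have "0 < k" "0 < b"
      using K B by (auto intro: gr0I)
    then have "real k \<le> real (k * b)" by simp
    then have "real k \<le> x"
      using kb(4) by (rule order_trans)
    moreover have "real b \<le> x / real k"
      using kb(4) \<open>0 < k\<close> by (simp add: field_simps)
    ultimately have "k \<in> ?F" "real b \<le> x / real k"
      using kb by auto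
    then show "a \<in> (\<lambda>(k, b). k * b) ` ?S"
      using kb by (auto intro!: image_eqI[of _ _ "(k, b)"])
  next
    fix a assume "a \<in> (\<lambda>(k, b). k * b) ` ?S"
    then obtain k b where kb: "k \<in> K" "b \<in> B" "a = k * b" "real b \<le> x / real k"
      by auto
    moreover have "0 < k" using kb K by (auto intro: gr0I)
    ultimately show "a \<in> {a \<in> A. real a \<le> x}"
      using img by (force simp: field_simps)
  qed
  moreover have "inj_on (\<lambda>(k, b). k * b) ?S"
    by (rule inj_on_subset[OF inj]) auto
  ultimately have "count_upto A x = card ?S"
    by (simp add: count_upto_def card_image)
  also have "\<dots> = (\<Sum>k\<in>?F. count_upto B (x / real k))"
    unfolding count_upto_def by (rule card_SigmaI) (auto intro: finite_below_real)
  finally have "((\<lambda>k. real (count_upto B (x / real k))) has_sum real (count_upto A x)) ?F"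
    by (intro has_sum_finiteI finite_below_real) simp
  moreover have "count_upto B (x / real k) = 0" if "k \<in> K - ?F" for k
  proof -
    have "0 < k" using that K by (auto intro: gr0I)
    have "x / real k < 1"
      using that \<open>0 < k\<close> by auto
    moreover have "1 \<le> real b" if "b \<in> B" for b
      using that B by (cases b) auto
    ultimately have none: "{b \<in> B. real b \<le> x / real k} = {}"
      by fastforce
    show ?thesis
      by (simp only: count_upto_def none card.empty)
  qed
  ultimately show ?thesis
    by (subst has_sum_cong_neutral[where S = ?F and T = K, symmetric]) auto
qed


section \<open>Natural density\<close>

lemma has_natural_density_unique:
  "has_natural_density B d \<Longrightarrow> has_natural_density B d' \<Longrightarrow> d = d'"
  unfolding has_natural_density_def by (rule tendsto_unique) auto

lemma has_natural_density_Diff: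
  assumes "has_natural_density B d" "has_natural_density A c" "A \<subseteq> B"
  shows "has_natural_density (B - A) (d - c)"
  using tendsto_diff[OF assms(1,2)[unfolded has_natural_density_def]] assms(3)
  unfolding has_natural_density_def by (simp add: count_upto_Diff diff_divide_distrib)

lemma has_natural_density_positive: "has_natural_density {0<..} 1"
  unfolding has_natural_density_def
proof (rule tendsto_sandwich)
  show "\<forall>\<^sub>F x::real in at_top. 1 - 1 / x \<le> real (count_upto {0<..} x) / x"
    using eventually_gt_at_top[of 0]
  proof eventually_elim
    case (elim x)
    have "x - 1 \<le> real (nat \<lfloor>x\<rfloor>)" using elim by linarith
    then have "(x - 1) / x \<le> real (nat \<lfloor>x\<rfloor>) / x"
      using elim by (intro divide_right_mono) auto
    then show ?case
      using elim by (simp add: count_upto_positive diff_divide_distrib)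
  qed
  show "\<forall>\<^sub>F x::real in at_top. real (count_upto {0<..} x) / x \<le> 1"
    using eventually_gt_at_top[of 0] by eventually_elim (simp add: count_upto_le)
  show "((\<lambda>x::real. 1 - 1 / x) \<longlongrightarrow> 1) at_top"
    by (rule tendsto_eq_intros tendsto_divide_0 filterlim_ident filterlim_at_top_imp_at_infinity | simp)+
qed (rule tendsto_const)

text \<open>
  A bound that reproduces itself with a factor less than one, up to an arbitrarily small error,
  can be improved until it vanishes: the infimum of the asymptotic bounds for \<open>\<bar>h\<bar>\<close> cannot
  be positive.
\<close>

lemma tendsto_0_if_bound_contracts:
  fixes h :: "real \<Rightarrow> real"
  assumes bounded: "\<forall>\<^sub>F x in at_top. \<bar>h x\<bar> \<le> M"
    and q: "0 \<le> q" "q < 1"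
    and contract: "\<And>C \<epsilon>. 0 \<le> C \<Longrightarrow> 0 < \<epsilon> \<Longrightarrow> \<forall>\<^sub>F x in at_top. \<bar>h x\<bar> \<le> C
                     \<Longrightarrow> \<forall>\<^sub>F x in at_top. \<bar>h x\<bar> \<le> q * C + \<epsilon>"
  shows "(h \<longlongrightarrow> 0) at_top"
proof -
  define S where "S = {C. 0 \<le> C \<and> (\<forall>\<^sub>F x in at_top. \<bar>h x\<bar> \<le> C)}"
  have "\<exists>x. \<bar>h x\<bar> \<le> M"
    using eventually_happens[OF bounded] by auto
  then have "0 \<le> M" using abs_ge_zero order_trans by blast
  then have "M \<in> S"
    using bounded by (simp add: S_def)
  then have ne: "S \<noteq> {}" by auto
  have bdd: "bdd_below S"
    by (auto simp: S_def bdd_below_def)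
  define I where "I = Inf S"
  have "0 \<le> I"
    unfolding I_def using ne by (intro cInf_greatest) (auto simp: S_def)
  have "I = 0"
  proof (rule ccontr)
    assume "I \<noteq> 0"
    \<comment> \<open>Small enough for \<open>C < I + \<epsilon>\<close> to imply \<open>q * C + \<epsilon> < I\<close>.\<close>
    define \<epsilon> where "\<epsilon> = (1 - q) * I / 4"
    have "0 < \<epsilon>"
      using \<open>I \<noteq> 0\<close> \<open>0 \<le> I\<close> q by (simp add: \<epsilon>_def)
    then obtain C where C: "C \<in> S" "C < I + \<epsilon>"
      using cInf_lessD[OF ne, of "I + \<epsilon>"] by (auto simp: I_def)
    then have "\<forall>\<^sub>F x in at_top. \<bar>h x\<bar> \<le> q * C + \<epsilon>"
      using contract \<open>0 < \<epsilon>\<close> by (auto simp: S_def)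
    then have "q * C + \<epsilon> \<in> S"
      using C \<open>0 < \<epsilon>\<close> q by (simp add: S_def)
    then have "I \<le> q * C + \<epsilon>"
      unfolding I_def by (rule cInf_lower[OF _ bdd])
    also have "q * C \<le> q * (I + \<epsilon>)"
      using C q by (intro mult_left_mono) auto
    also have "q * (I + \<epsilon>) \<le> q * I + \<epsilon>"
      using q \<open>0 < \<epsilon>\<close> by (simp add: distrib_left mult_left_le_one_le)
    finally have "(1 - q) * I \<le> 2 * \<epsilon>" by (simp add: algebra_simps)
    moreover have "(1 - q) * I = 4 * \<epsilon>" by (simp add: \<epsilon>_def)
    ultimately show False
      using \<open>0 < \<epsilon>\<close> by linarith
  qed
  show ?thesis
  proof (rule tendstoI)
    fix \<epsilon> :: real assume "0 < \<epsilon>"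
    then obtain C where C: "C \<in> S" "C < \<epsilon>"
      using cInf_lessD[OF ne, of \<epsilon>] \<open>I = 0\<close> by (auto simp: I_def)
    then have "\<forall>\<^sub>F x in at_top. \<bar>h x\<bar> \<le> C" by (simp add: S_def)
    then show "\<forall>\<^sub>F x in at_top. dist (h x) 0 < \<epsilon>"
      by eventually_elim (use C in auto)
  qed
qed

text \<open>
  A density can be divided out of a product decomposition. Let \<open>h x\<close> be the deviation of
  \<open>B[x] / x\<close> from the expected value \<open>d / \<sigma>\<close>. The decomposition says that the sum
  \<open>\<Sum>k\<in>K. h (x / k) / k\<close> tends to \<open>0\<close>. The term with \<open>k = 1\<close> is \<open>h x\<close> itself, and the
  others have total weight \<open>\<sigma> - 1 < 1\<close>, so that every asymptotic bound for \<open>\<bar>h\<bar>\<close> can be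
  multiplied by \<open>\<sigma> - 1\<close>, up to an arbitrarily small error.
\<close>

lemma has_natural_density_factor:
  assumes bij: "bij_betw (\<lambda>(k, b). k * b) (K \<times> B) A"
    and K: "1 \<in> K" "0 \<notin> K" and B: "0 \<notin> B"
    and \<sigma>: "((\<lambda>k. 1 / real k) has_sum \<sigma>) K" "\<sigma> < 2"
    and A: "has_natural_density A d"
  shows "has_natural_density B (d / \<sigma>)"
proof -
  define c where "c = d / \<sigma>"
  define h where "h x = real (count_upto B x) / x - c" for x
  define r where "r x = real (count_upto A x) / x - d" for x
  define M where "M = 1 + \<bar>c\<bar>"
  have "0 < M" by (simp add: M_def add_pos_nonneg)
  have "sum (\<lambda>k. 1 / real k) {1} \<le> \<sigma>"
    using K by (intro finite_sum_le_has_sum[OF \<sigma>(1)]) auto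
  then have "1 \<le> \<sigma>" by simp
  have K_pos: "0 < k" if "k \<in> K" for k
    using that K by (auto intro: gr0I)
  have h_bound: "\<bar>h x\<bar> \<le> M" if "0 < x" for x
  proof -
    have "0 \<le> real (count_upto B x) / x" "real (count_upto B x) / x \<le> 1"
      using that count_upto_le[OF B, of x] by (auto simp: field_simps)
    then show ?thesis unfolding h_def M_def by linarith
  qed
  have h_sum: "((\<lambda>k. h (x / real k) / real k) has_sum r x) K" if "0 < x" for x
  proof -
    have "((\<lambda>k. real (count_upto B (x / real k)) * (1 / x) + 1 / real k * - c) has_sum
            (real (count_upto A x) * (1 / x) + \<sigma> * - c)) K"
      by (intro has_sum_add has_sum_cmult_left \<sigma> has_sum_count_upto_dilates[OF bij K(2) B that])
    also have "real (count_upto A x) * (1 / x) + \<sigma> * - c = r x"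
      using \<open>1 \<le> \<sigma>\<close> by (simp add: r_def c_def)
    finally show ?thesis
      by (rule has_sum_cong[THEN iffD1, rotated])
         (use that K_pos in \<open>auto simp: h_def field_simps\<close>)
  qed
  \<comment> \<open>An asymptotic bound for \<open>h\<close> applies to \<open>h (x / k)\<close> only for finitely many \<open>k\<close> at once;
    the terms with other \<open>k\<close> are estimated by the trivial bound \<open>M\<close>.\<close>
  have h_estimate:
    "\<bar>h x\<bar> \<le> \<bar>r x\<bar> + (\<Sum>k\<in>F - {1}. \<bar>h (x / real k)\<bar> / real k) + M * (\<sigma> - (\<Sum>k\<in>F. 1 / real k))"
    if x: "0 < x" and F: "finite F" "F \<subseteq> K" "1 \<in> F" for x F
  proof -
    let ?t = "r x - (\<Sum>k\<in>F. h (x / real k) / real k)"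
    have tail_sum: "((\<lambda>k. h (x / real k) / real k) has_sum ?t) (K - F)"
      by (intro has_sum_Diff h_sum x has_sum_finite F)
    have "((\<lambda>k. 1 / real k) has_sum (\<sigma> - (\<Sum>k\<in>F. 1 / real k))) (K - F)"
      by (intro has_sum_Diff \<sigma> has_sum_finite F)
    then have M_sum: "((\<lambda>k. M * (1 / real k)) has_sum (M * (\<sigma> - (\<Sum>k\<in>F. 1 / real k)))) (K - F)"
      by (rule has_sum_cmult_right)
    have term_bound: "\<bar>h (x / real k) / real k\<bar> \<le> M * (1 / real k)" if "k \<in> K - F" for k
      using h_bound[of "x / real k"] x K_pos[of k] that by (simp add: divide_right_mono)
    have "?t \<le> M * (\<sigma> - (\<Sum>k\<in>F. 1 / real k))"
      by (rule has_sum_mono[OF tail_sum M_sum]) (use term_bound abs_le_D1 in blast)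
    moreover have "- ?t \<le> M * (\<sigma> - (\<Sum>k\<in>F. 1 / real k))"
      by (rule has_sum_mono[OF has_sum_uminusI[OF tail_sum] M_sum])
         (use term_bound abs_le_D2 in blast)
    ultimately have tail: "\<bar>?t\<bar> \<le> M * (\<sigma> - (\<Sum>k\<in>F. 1 / real k))" by linarith
    have "(\<Sum>k\<in>F. h (x / real k) / real k) = h x + (\<Sum>k\<in>F - {1}. h (x / real k) / real k)"
      using F by (subst sum.remove[of _ 1]) auto
    moreover have "\<bar>\<Sum>k\<in>F - {1}. h (x / real k) / real k\<bar> \<le> (\<Sum>k\<in>F - {1}. \<bar>h (x / real k)\<bar> / real k)"
      by (rule order_trans[OF sum_abs]) (simp add: abs_divide)
    ultimately show ?thesis using tail by linarith
  qed
  have "(h \<longlongrightarrow> 0) at_top"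
  proof (rule tendsto_0_if_bound_contracts)
    show "\<forall>\<^sub>F x in at_top. \<bar>h x\<bar> \<le> M"
      using eventually_gt_at_top[of 0] by eventually_elim (rule h_bound)
    show "0 \<le> \<sigma> - 1" "\<sigma> - 1 < 1"
      using \<open>1 \<le> \<sigma>\<close> \<sigma>(2) by auto
  next
    fix C \<epsilon> :: real
    assume C: "0 \<le> C" and \<epsilon>: "0 < \<epsilon>" and hC: "\<forall>\<^sub>F x in at_top. \<bar>h x\<bar> \<le> C"
    obtain F0 where F0: "finite F0" "F0 \<subseteq> K" "dist (\<Sum>k\<in>F0. 1 / real k) \<sigma> \<le> \<epsilon> / (2 * M)"
      using has_sum_finite_approximation[OF \<sigma>(1), of "\<epsilon> / (2 * M)"] \<epsilon> \<open>0 < M\<close> by auto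
    define F where "F = insert 1 F0"
    have F: "finite F" "F \<subseteq> K" "1 \<in> F"
      using F0 K by (auto simp: F_def)
    have "(\<Sum>k\<in>F0. 1 / real k) \<le> (\<Sum>k\<in>F. 1 / real k)"
      using F by (intro sum_mono2) (auto simp: F_def)
    then have "\<sigma> - (\<Sum>k\<in>F. 1 / real k) \<le> \<epsilon> / (2 * M)"
      using F0(3) by (simp add: dist_real_def)
    then have tail: "M * (\<sigma> - (\<Sum>k\<in>F. 1 / real k)) \<le> \<epsilon> / 2"
      using \<open>0 < M\<close> by (simp add: field_simps)
    have F_le: "(\<Sum>k\<in>F - {1}. 1 / real k) \<le> \<sigma> - 1"
    proof -
      have "(\<Sum>k\<in>F. 1 / real k) \<le> \<sigma>"
        by (rule finite_sum_le_has_sum[OF \<sigma>(1)]) (use F in auto)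
      then show ?thesis using F by (simp add: sum.remove[of F 1])
    qed
    have "(r \<longlongrightarrow> 0) at_top"
      using A tendsto_diff[of _ d at_top "\<lambda>_. d" d]
      unfolding has_natural_density_def r_def by force
    then have "\<forall>\<^sub>F x in at_top. \<bar>r x\<bar> < \<epsilon> / 2"
      using \<epsilon> by (auto dest: tendstoD[where e = "\<epsilon> / 2"])
    moreover have "\<forall>\<^sub>F x in at_top. \<forall>k\<in>F. \<bar>h (x / real k)\<bar> \<le> C"
    proof (intro eventually_ball_finite F ballI)
      fix k assume "k \<in> F"
      then have "0 < 1 / real k" using F K_pos by auto
      then have "filterlim (\<lambda>x. (1 / real k) * x) at_top at_top"
        by (rule filterlim_tendsto_pos_mult_at_top[OF tendsto_const _ filterlim_ident])
      then show "\<forall>\<^sub>F x in at_top. \<bar>h (x / real k)\<bar> \<le> C"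
        using eventually_compose_filterlim[OF hC] by fastforce
    qed
    moreover note eventually_gt_at_top[of "0::real"]
    ultimately show "\<forall>\<^sub>F x in at_top. \<bar>h x\<bar> \<le> (\<sigma> - 1) * C + \<epsilon>"
    proof eventually_elim
      case (elim x)
      have "(\<Sum>k\<in>F - {1}. \<bar>h (x / real k)\<bar> / real k) \<le> (\<Sum>k\<in>F - {1}. 1 / real k * C)"
        using elim by (intro sum_mono) (auto simp: divide_right_mono)
      also have "\<dots> = (\<Sum>k\<in>F - {1}. 1 / real k) * C"
        by (simp add: sum_distrib_right)
      also have "\<dots> \<le> (\<sigma> - 1) * C"
        using F_le C by (rule mult_right_mono)
      finally show ?case
        using h_estimate[OF elim(3) F] elim(1) tail by linarith
    qed
  qed
  then have "((\<lambda>x. h x + c) \<longlongrightarrow> 0 + c) at_top"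
    by (intro tendsto_add tendsto_const)
  then show ?thesis
    by (simp add: has_natural_density_def h_def c_def)
qed


section \<open>Square-free numbers\<close>

lemma square_part_mult_squarefree:
  fixes m b :: nat
  assumes "squarefree b"
  shows "square_part (m\<^sup>2 * b) = m"
proof (rule dvd_antisym)
  show "m dvd square_part (m\<^sup>2 * b)"
    by (simp add: dvd_square_part_iff)
  define x where "x = square_part (m\<^sup>2 * b)"
  have x: "x\<^sup>2 dvd m\<^sup>2 * b" by (simp add: x_def)
  show "x dvd m"
  proof (cases "m = 0")
    case False
    then obtain x' m' where *: "x = x' * gcd x m" "m = m' * gcd x m" "coprime x' m'"
      using gcd_coprime_exists[of x m] by auto
    have "x'\<^sup>2 * (gcd x m)\<^sup>2 dvd (m'\<^sup>2 * b) * (gcd x m)\<^sup>2"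
      using x * by (metis (no_types, lifting) mult.assoc mult.commute power_mult_distrib)
    then have "x'\<^sup>2 dvd m'\<^sup>2 * b"
      using False by simp
    moreover have "coprime (x'\<^sup>2) (m'\<^sup>2)"
      using * by simp
    ultimately have "x'\<^sup>2 dvd b"
      by (simp add: coprime_dvd_mult_right_iff)
    then have "x' dvd 1"
      using assms by (rule squarefreeD[rotated])
    then show ?thesis
      using * by (metis dvd_triv_right mult_1 nat_dvd_1_iff_1)
  qed simp
qed

lemma bij_betw_square_times_squarefree:
  "bij_betw (\<lambda>(k, b). k * b) (power2 ` {0<..} \<times> {n::nat. squarefree n}) {0<..}"
  unfolding bij_betw_def
proof
  show "inj_on (\<lambda>(k, b). k * b) (power2 ` {0<..} \<times> {n::nat. squarefree n})"
  proof (rule inj_onI, clarsimp)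
    fix m b m' b' :: nat
    assume *: "squarefree b" "squarefree b'" "m\<^sup>2 * b = m'\<^sup>2 * b'" "0 < m" "0 < m'"
    then have "m = m'"
      by (metis square_part_mult_squarefree)
    then show "m = m' \<and> b = b'"
      using * by simp
  qed
  show "(\<lambda>(k, b). k * b) ` (power2 ` {0<..} \<times> {n::nat. squarefree n}) = {0<..}"
  proof (intro equalityI subsetI)
    fix n :: nat assume "n \<in> {0<..}"
    then have "square_part n \<in> {0<..}"
      by (metis greaterThan_iff neq0_conv square_part_0_iff)
    moreover have "n = (square_part n)\<^sup>2 * squarefree_part n"
      using squarefree_decompose[of n] by (simp add: mult.commute)
    ultimately show "n \<in> (\<lambda>(k, b). k * b) ` (power2 ` {0<..} \<times> {n. squarefree n})"
      by (intro image_eqI[of _ _ "((square_part n)\<^sup>2, squarefree_part n)"]) auto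
  qed (auto intro!: gr0I)
qed

text \<open>
  Every positive integer is uniquely a positive square times a square-free number, and the
  reciprocals of the squares add up to \<open>\<pi>\<^sup>2 / 6\<close>. That this is less than \<open>2\<close> is what makes
  the contraction argument applicable.
\<close>

lemma has_natural_density_squarefree: "has_natural_density {n. squarefree n} (6 / pi\<^sup>2)"
proof -
  have inj: "inj (\<lambda>n. (Suc n)\<^sup>2)"
    by (auto simp: inj_def)
  have "((\<lambda>n::nat. 1 / (real n + 1)\<^sup>2) has_sum (pi\<^sup>2 / 6)) UNIV"
    by (rule sums_nonneg_imp_has_sum) (use inverse_squares_sums in \<open>auto simp: add.commute\<close>)
  also have "(\<lambda>n::nat. 1 / (real n + 1)\<^sup>2) = (\<lambda>k. 1 / real k) \<circ> (\<lambda>n. (Suc n)\<^sup>2)"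
    by (auto simp: add.commute)
  finally have "((\<lambda>k. 1 / real k) has_sum (pi\<^sup>2 / 6)) ((\<lambda>n. (Suc n)\<^sup>2) ` UNIV)"
    by (simp only: has_sum_reindex[OF inj])
  also have "(\<lambda>n. (Suc n)\<^sup>2) ` UNIV = power2 ` {0<..}"
    by (simp add: greaterThan_0 image_image)
  finally have *: "((\<lambda>k. 1 / real k) has_sum (pi\<^sup>2 / 6)) (power2 ` {0<..})" .
  have "pi\<^sup>2 < 3.2\<^sup>2"
    using pi_approx by (intro power_strict_mono) auto
  then have "pi\<^sup>2 / 6 < 2"
    by (simp add: power2_eq_square)
  then have "has_natural_density {n. squarefree n} (1 / (pi\<^sup>2 / 6))"
    by (intro has_natural_density_factor[OF bij_betw_square_times_squarefree _ _ _ *]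
          has_natural_density_positive) (auto intro: image_eqI[of _ _ 1])
  then show ?thesis by simp
qed


section \<open>Prescribing finitely many primes\<close>

definition sieved :: "nat set \<Rightarrow> nat set \<Rightarrow> nat set" where
  "sieved T P = {n. n > 0 \<and> squarefree n \<and> (\<forall>p\<in>T. p dvd n) \<and> (\<forall>p\<in>P. \<not> p dvd n)}"

lemma bij_betw_sieved_insert:
  assumes p: "prime p" "p \<notin> P" and P: "\<forall>q\<in>P. prime q"
  shows "bij_betw (\<lambda>(k, b). k * b) ({1, p} \<times> sieved {} (insert p P)) (sieved {} P)"
  unfolding bij_betw_def
proof
  have "0 < p" "1 < p"
    using p(1) prime_gt_0_nat prime_gt_1_nat by auto
  show "inj_on (\<lambda>(k, b). k * b) ({1, p} \<times> sieved {} (insert p P))"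
  proof (rule inj_onI, clarify)
    fix k b k' b'
    assume *: "k \<in> {1, p}" "b \<in> sieved {} (insert p P)"
      "k' \<in> {1, p}" "b' \<in> sieved {} (insert p P)" "k * b = k' * b'"
    have "\<not> p dvd b" "\<not> p dvd b'"
      using * by (auto simp: sieved_def)
    moreover have "b \<noteq> p * b'" "b' \<noteq> p * b"
      using calculation by auto
    ultimately have "k = k'"
      using * by force
    then show "k = k' \<and> b = b'"
      using * \<open>0 < p\<close> by auto
  qed
  show "(\<lambda>(k, b). k * b) ` ({1, p} \<times> sieved {} (insert p P)) = sieved {} P"
  proof (intro equalityI subsetI)
    fix n assume "n \<in> (\<lambda>(k, b). k * b) ` ({1, p} \<times> sieved {} (insert p P))"
    then obtain b where b: "b \<in> sieved {} (insert p P)" "n = b \<or> n = p * b"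
      by auto
    have "p * b \<in> sieved {} P"
    proof -
      have "coprime p b"
        using b p by (auto simp: sieved_def prime_imp_coprime)
      then have "squarefree (p * b)"
        using b squarefree_prime[OF p(1)] by (intro squarefree_mult_coprime) (auto simp: sieved_def)
      moreover have "\<not> q dvd p * b" if "q \<in> P" for q
      proof -
        have "prime q" "q \<noteq> p"
          using that p P by auto
        then have "\<not> q dvd p"
          using p(1) primes_dvd_imp_eq by blast
        then show ?thesis
          using that b \<open>prime q\<close> by (auto simp: sieved_def prime_dvd_mult_iff)
      qed
      ultimately show ?thesis
        using b \<open>0 < p\<close> by (auto simp: sieved_def)
    qed
    then show "n \<in> sieved {} P"
      using b by (auto simp: sieved_def)
  next
    fix n assume n: "n \<in> sieved {} P"
    show "n \<in> (\<lambda>(k, b). k * b) ` ({1, p} \<times> sieved {} (insert p P))"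
    proof (cases "p dvd n")
      case False
      then show ?thesis
        using n by (intro image_eqI[of _ _ "(1, n)"]) (auto simp: sieved_def)
    next
      case True
      then obtain b where b: "n = p * b" ..
      have "\<not> p dvd b"
      proof
        assume "p dvd b"
        then have "p\<^sup>2 dvd n"
          by (simp add: b power2_eq_square)
        then have "p dvd 1"
          using n squarefreeD[of n p] by (simp add: sieved_def)
        then show False using \<open>1 < p\<close> by simp
      qed
      moreover have "squarefree b"
        using n squarefree_mono[of b n] by (auto simp: sieved_def b)
      ultimately have "b \<in> sieved {} (insert p P)"
        using n by (auto simp: sieved_def b)
      then show ?thesis
        using b by (intro image_eqI[of _ _ "(p, b)"]) auto
    qed
  qed
qed

text \<open>
  Among the square-free numbers without divisors in \<open>P\<close>, multiplication by \<open>p\<close> matches those that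
  \<open>p\<close> does not divide with those that it does. The former make up the fraction \<open>1 / (1 + 1 / p)\<close>.
\<close>

lemma has_natural_density_sieved_no_divisors:
  assumes "finite P" "\<forall>p\<in>P. prime p"
  shows "has_natural_density (sieved {} P) (6 / pi\<^sup>2 * (\<Prod>p\<in>P. real p / (1 + real p)))"
  using assms
proof (induction P)
  case empty
  have "sieved {} {} = {n. squarefree n}"
    by (auto simp: sieved_def intro!: gr0I)
  then show ?case
    using has_natural_density_squarefree by simp
next
  case (insert p P)
  then have p: "prime p" "2 \<le> p"
    by (auto simp: prime_ge_2_nat)
  have \<sigma>: "((\<lambda>k. 1 / real k) has_sum (1 + 1 / real p)) {1, p}"
    using p by (intro has_sum_finiteI) auto
  have "1 / real p < 1" using p by simp
  then have "has_natural_density (sieved {} (insert p P))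
          (6 / pi\<^sup>2 * (\<Prod>q\<in>P. real q / (1 + real q)) / (1 + 1 / real p))"
    using insert p
    by (intro has_natural_density_factor[OF bij_betw_sieved_insert _ _ _ \<sigma>])
       (auto simp: sieved_def)
  moreover have "z / (1 + 1 / real p) = z * (real p / (1 + real p))" for z
    using p by (simp add: field_simps)
  ultimately show ?case
    using insert by (simp add: mult_ac)
qed

text \<open>
  A prime is moved into \<open>T\<close> by complementation, which gives the factor
  \<open>1 - p / (1 + p) = 1 / (1 + p)\<close>.
\<close>

lemma has_natural_density_sieved_finite:
  assumes "finite T" "\<forall>p\<in>T. prime p" "finite P" "\<forall>p\<in>P. prime p" "P \<inter> T = {}"
  shows "has_natural_density (sieved T P)
           (6 / pi\<^sup>2 * (\<Prod>p\<in>T. 1 / (1 + real p)) * (\<Prod>p\<in>P. real p / (1 + real p)))"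
  using assms
proof (induction T arbitrary: P)
  case empty
  then show ?case
    using has_natural_density_sieved_no_divisors[of P] by simp
next
  case (insert p T)
  let ?c = "6 / pi\<^sup>2 * (\<Prod>q\<in>T. 1 / (1 + real q)) * (\<Prod>q\<in>P. real q / (1 + real q))"
  have p: "p \<notin> P" using insert by auto
  have "has_natural_density (sieved T P) ?c"
    using insert by auto
  moreover have "has_natural_density (sieved T (insert p P)) (?c * (real p / (1 + real p)))"
  proof -
    have "has_natural_density (sieved T (insert p P))
            (6 / pi\<^sup>2 * (\<Prod>q\<in>T. 1 / (1 + real q)) * (\<Prod>q\<in>insert p P. real q / (1 + real q)))"
      using insert.prems insert.hyps by (intro insert.IH) auto
    then show ?thesis
      using insert.prems p by (simp add: mult_ac)
  qed
  ultimately have "has_natural_density (sieved T P - sieved T (insert p P))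
                     (?c - ?c * (real p / (1 + real p)))"
    by (rule has_natural_density_Diff) (auto simp: sieved_def)
  also have "sieved T P - sieved T (insert p P) = sieved (insert p T) P"
    by (auto simp: sieved_def)
  also have "?c - ?c * (real p / (1 + real p)) = ?c * (1 / (1 + real p))"
  proof -
    have "c - c * (real p / (1 + real p)) = c * (1 / (1 + real p))" for c
      by (simp add: field_simps)
    then show ?thesis .
  qed
  finally show ?case
    using insert.hyps by (simp add: mult_ac)
qed


section \<open>Excluding infinitely many primes\<close>

lemma prod_tendsto_nonneg:
  fixes e :: "nat \<Rightarrow> nat"
  shows "\<exists>L\<ge>0. (\<lambda>n. \<Prod>i<n. real (e i) / (1 + real (e i))) \<longlonglongrightarrow> L"
proof -
  let ?u = "\<lambda>n. \<Prod>i<n. real (e i) / (1 + real (e i))"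
  have nonneg: "0 \<le> ?u n" for n
    by (intro prod_nonneg) auto
  have "decseq ?u"
  proof (rule decseq_SucI)
    show "?u (Suc n) \<le> ?u n" for n
      unfolding prod.lessThan_Suc by (rule mult_right_le_one_le[OF nonneg]) auto
  qed
  then obtain L where "?u \<longlonglongrightarrow> L"
    using decseq_convergent[of ?u 0] nonneg by blast
  moreover from this have "0 \<le> L"
    by (rule LIMSEQ_le_const) (use nonneg in blast)
  ultimately show ?thesis by blast
qed

text \<open>
  The reciprocal of the product dominates the sum, as \<open>1 + (\<Sum>i<n. a i) \<le> (\<Prod>i<n. 1 + a i)\<close>
  for nonnegative \<open>a i\<close>.
\<close>

lemma summable_inverse_if_prod_tendsto_pos:
  fixes e :: "nat \<Rightarrow> nat"
  assumes e: "\<And>i. 0 < e i"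
    and lim: "(\<lambda>n. \<Prod>i<n. real (e i) / (1 + real (e i))) \<longlonglongrightarrow> L" and L: "0 < L"
  shows "summable (\<lambda>i. 1 / real (e i))"
proof -
  let ?u = "\<lambda>n. \<Prod>i<n. real (e i) / (1 + real (e i))"
  have sum_le: "(\<Sum>i<n. 1 / real (e i)) \<le> (\<Prod>i<n. 1 + 1 / real (e i))" for n
  proof -
    have "1 + (\<Sum>i<n. 1 / real (e i)) \<le> (\<Prod>i<n. 1 + 1 / real (e i))"
    proof (induction n)
      case (Suc n)
      have "1 \<le> (\<Prod>i<n. 1 + 1 / real (e i))"
        by (intro prod_ge_1) auto
      then have "1 / real (e n) \<le> (\<Prod>i<n. 1 + 1 / real (e i)) * (1 / real (e n))"
        using mult_right_mono[of 1 _ "1 / real (e n)"] by simp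
      then show ?case
        using Suc by (simp add: distrib_left)
    qed simp
    then show ?thesis by simp
  qed
  have "(\<Prod>i<n. 1 + 1 / real (e i)) = inverse (?u n)" for n
    unfolding prod_inversef[symmetric] comp_def
    using e by (intro prod.cong) (auto simp: field_simps)
  then have "(\<lambda>n. \<Prod>i<n. 1 + 1 / real (e i)) \<longlonglongrightarrow> inverse L"
    using tendsto_inverse[OF lim] L by simp
  then have "Bseq (\<lambda>n. \<Prod>i<n. 1 + 1 / real (e i))"
    by (intro convergent_imp_Bseq convergentI)
  then obtain c where c: "\<And>n. \<bar>\<Prod>i<n. 1 + 1 / real (e i)\<bar> \<le> c"
    by (auto simp: Bseq_def)
  show ?thesis
  proof (rule summableI_nonneg_bounded[where x = c])
    show "(\<Sum>i<n. 1 / real (e i)) \<le> c" for n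
      using sum_le[of n] c[of n] by linarith
  qed simp
qed

text \<open>
  Only the divisors up to \<open>x\<close> matter for a count up to \<open>x\<close>, and each of them has at most
  \<open>x / e i\<close> multiples.
\<close>

lemma count_upto_multiples_tail_le:
  fixes e :: "nat \<Rightarrow> nat"
  assumes e: "inj e" "\<And>i. 0 < e i" and sm: "summable (\<lambda>i. 1 / real (e i))" and x: "0 \<le> x"
  shows "real (count_upto {t. 0 < t \<and> (\<exists>i\<ge>n. e i dvd t)} x)
           \<le> x * ((\<Sum>i. 1 / real (e i)) - (\<Sum>i<n. 1 / real (e i)))"
proof -
  let ?I = "{i. n \<le> i \<and> real (e i) \<le> x}"
  have "finite (e ` ?I)"
    by (rule finite_subset[OF _ finite_below_real[of UNIV x]]) auto
  then have fin: "finite ?I"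
    using e(1) by (simp add: finite_image_iff inj_on_def)
  have "{t \<in> {t. 0 < t \<and> (\<exists>i\<ge>n. e i dvd t)}. real t \<le> x}
          \<subseteq> (\<Union>i\<in>?I. {t \<in> {t. 0 < t \<and> e i dvd t}. real t \<le> x})"
  proof clarsimp
    fix t i assume "0 < t" "n \<le> i" "e i dvd t" "real t \<le> x"
    then have "real (e i) \<le> real t"
      by (simp add: dvd_imp_le)
    then show "\<exists>i\<ge>n. real (e i) \<le> x \<and> e i dvd t"
      using \<open>n \<le> i\<close> \<open>e i dvd t\<close> \<open>real t \<le> x\<close> by (meson order_trans)
  qed
  then have "count_upto {t. 0 < t \<and> (\<exists>i\<ge>n. e i dvd t)} x
      \<le> card (\<Union>i\<in>?I. {t \<in> {t. 0 < t \<and> e i dvd t}. real t \<le> x})"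
    unfolding count_upto_def by (intro card_mono finite_UN_I fin finite_below_real)
  also have "\<dots> \<le> (\<Sum>i\<in>?I. count_upto {t. 0 < t \<and> e i dvd t} x)"
    unfolding count_upto_def by (rule card_UN_le[OF fin])
  finally have "real (count_upto {t. 0 < t \<and> (\<exists>i\<ge>n. e i dvd t)} x)
      \<le> (\<Sum>i\<in>?I. real (count_upto {t. 0 < t \<and> e i dvd t} x))"
    by (simp flip: of_nat_sum)
  also have "\<dots> \<le> (\<Sum>i\<in>?I. x / real (e i))"
    using e x by (intro sum_mono count_upto_multiples_le)
  also have "\<dots> = x * (\<Sum>i\<in>?I. 1 / real (e i))"
    by (simp add: sum_distrib_left)
  also have "\<dots> \<le> x * ((\<Sum>i. 1 / real (e i)) - (\<Sum>i<n. 1 / real (e i)))"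
  proof (rule mult_left_mono[OF _ x])
    have "(\<Sum>i\<in>?I. 1 / real (e i)) + (\<Sum>i<n. 1 / real (e i)) = (\<Sum>i\<in>?I \<union> {..<n}. 1 / real (e i))"
      using fin by (intro sum.union_disjoint[symmetric]) auto
    also have "\<dots> \<le> (\<Sum>i. 1 / real (e i))"
      using fin sm by (intro sum_le_suminf) auto
    finally show "(\<Sum>i\<in>?I. 1 / real (e i)) \<le> (\<Sum>i. 1 / real (e i)) - (\<Sum>i<n. 1 / real (e i))"
      by simp
  qed
  finally show ?thesis .
qed

text \<open>
  The set is squeezed from above by the sets that exclude only the first \<open>n\<close> primes of \<open>P\<close>.
  If the product vanishes, this suffices, as the counts are nonnegative. Otherwise the
  reciprocals of the primes in \<open>P\<close> are summable, and the numbers that the later primes remove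
  have small upper density.
\<close>

lemma has_natural_density_sieved_infinite:
  assumes T: "finite T" "\<forall>p\<in>T. prime p" and P: "\<forall>p\<in>P. prime p" "P \<inter> T = {}"
    and e: "bij_betw e (UNIV :: nat set) P"
    and lim: "(\<lambda>n. \<Prod>i<n. real (e i) / (1 + real (e i))) \<longlonglongrightarrow> L" and L: "0 \<le> L"
  shows "has_natural_density (sieved T P) (6 / pi\<^sup>2 * (\<Prod>p\<in>T. 1 / (1 + real p)) * L)"
proof -
  define c where "c = 6 / pi\<^sup>2 * (\<Prod>p\<in>T. 1 / (1 + real p))"
  define B where "B n = sieved T (e ` {..<n})" for n
  define d where "d n = c * (\<Prod>i<n. real (e i) / (1 + real (e i)))" for n
  have inj: "inj e" and e_in: "e i \<in> P" for i
    using e by (auto simp: bij_betw_def)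
  have e_pos: "0 < e i" for i
    using P e_in prime_gt_0_nat by blast
  have "has_natural_density (B n) (d n)" for n
  proof -
    have "has_natural_density (B n) (c * (\<Prod>p\<in>e ` {..<n}. real p / (1 + real p)))"
      unfolding B_def c_def using P e_in
      by (intro has_natural_density_sieved_finite T) auto
    then show ?thesis
      using inj by (simp add: d_def prod.reindex inj_on_def)
  qed
  then have B_lim: "((\<lambda>x. real (count_upto (B n) x) / x) \<longlongrightarrow> d n) at_top" for n
    by (simp add: has_natural_density_def)
  have d_lim: "d \<longlonglongrightarrow> c * L"
    unfolding d_def by (intro tendsto_intros lim)
  have sub: "sieved T P \<subseteq> B n" for n
    using e_in by (auto simp: B_def sieved_def)
  have "((\<lambda>x. real (count_upto (sieved T P) x) / x) \<longlongrightarrow> c * L) at_top"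
  proof (rule order_tendstoI)
    fix a assume "c * L < a"
    then have "\<forall>\<^sub>F n in sequentially. d n < a"
      using d_lim by (rule order_tendstoD(2)[rotated])
    then obtain n where "d n < a"
      using eventually_happens'[OF sequentially_bot] by blast
    then have "\<forall>\<^sub>F x in at_top. real (count_upto (B n) x) / x < a"
      using B_lim order_tendstoD(2) by blast
    then show "\<forall>\<^sub>F x in at_top. real (count_upto (sieved T P) x) / x < a"
      using eventually_gt_at_top[of 0]
    proof eventually_elim
      case (elim x)
      have "real (count_upto (sieved T P) x) / x \<le> real (count_upto (B n) x) / x"
        using elim count_upto_mono[OF sub] by (intro divide_right_mono) auto
      then show ?case using elim by simp
    qed
  next
    fix a assume a: "a < c * L"
    show "\<forall>\<^sub>F x in at_top. a < real (count_upto (sieved T P) x) / x"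
    proof (cases "L = 0")
      case True
      show ?thesis
        using eventually_gt_at_top[of 0]
      proof eventually_elim
        case (elim x)
        have "0 \<le> real (count_upto (sieved T P) x) / x" using elim by simp
        then show ?case using a True by simp
      qed
    next
      case False
      then have sm: "summable (\<lambda>i. 1 / real (e i))"
        using L by (intro summable_inverse_if_prod_tendsto_pos[OF e_pos lim]) auto
      define t where "t n = (\<Sum>i. 1 / real (e i)) - (\<Sum>i<n. 1 / real (e i))" for n
      have "t \<longlonglongrightarrow> 0"
        unfolding t_def
        using tendsto_diff[OF tendsto_const summable_LIMSEQ[OF sm], of "\<Sum>i. 1 / real (e i)"] by simp
      then have "(\<lambda>n. d n - t n) \<longlonglongrightarrow> c * L"
        using tendsto_diff[OF d_lim] by fastforce
      then have "\<forall>\<^sub>F n in sequentially. a < d n - t n"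
        using a by (rule order_tendstoD(1))
      then obtain n where "a < d n - t n"
        using eventually_happens'[OF sequentially_bot] by blast
      then have "a + t n < d n" by simp
      then have "\<forall>\<^sub>F x in at_top. a + t n < real (count_upto (B n) x) / x"
        using B_lim order_tendstoD(1) by blast
      then show ?thesis
        using eventually_gt_at_top[of 0]
      proof eventually_elim
        case (elim x)
        have "B n - sieved T P \<subseteq> {t. 0 < t \<and> (\<exists>i\<ge>n. e i dvd t)}"
        proof
          fix b assume b: "b \<in> B n - sieved T P"
          then obtain p where "p \<in> P" "p dvd b"
            by (auto simp: B_def sieved_def)
          moreover obtain i where "p = e i"
            using e \<open>p \<in> P\<close> by (auto simp: bij_betw_def)
          moreover have "\<not> i < n"
            using b \<open>p dvd b\<close> \<open>p = e i\<close> by (auto simp: B_def sieved_def)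
          ultimately show "b \<in> {t. 0 < t \<and> (\<exists>i\<ge>n. e i dvd t)}"
            using b by (auto simp: B_def sieved_def not_less)
        qed
        from count_upto_mono[OF this, of x]
        have "real (count_upto (B n - sieved T P) x)
                \<le> real (count_upto {t. 0 < t \<and> (\<exists>i\<ge>n. e i dvd t)} x)"
          by simp
        also have "\<dots> \<le> x * t n"
          unfolding t_def using elim by (intro count_upto_multiples_tail_le inj e_pos sm) auto
        finally have "real (count_upto (B n) x) - x * t n \<le> real (count_upto (sieved T P) x)"
          by (simp add: count_upto_Diff[OF sub])
        moreover have "a * x < real (count_upto (B n) x) - x * t n"
          using elim by (simp add: field_simps)
        ultimately show ?case
          using elim by (simp add: field_simps)
      qed
    qed
  qed
  then show ?thesis
    by (simp add: has_natural_density_def c_def)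
qed

theorem theorem1p1:
  fixes P T :: "nat set"
  assumes "\<forall>p\<in>P. prime p"
    and "\<forall>p\<in>T. prime p"
    and "P \<inter> T = {}"
    and "finite T"
  shows "\<exists>L. has_prod_over (\<lambda>p. real p / (1 + real p)) P L \<and>
             has_natural_density
               {n. n > 0 \<and> squarefree n \<and> (\<forall>p\<in>T. p dvd n) \<and> (\<forall>p\<in>P. \<not> p dvd n)}
               (6 / pi\<^sup>2 * (\<Prod>p\<in>T. 1 / (1 + real p)) * L)"
  unfolding sieved_def[symmetric]
proof (cases "finite P")
  case True
  then show "\<exists>L. has_prod_over (\<lambda>p. real p / (1 + real p)) P L \<and>
               has_natural_density (sieved T P) (6 / pi\<^sup>2 * (\<Prod>p\<in>T. 1 / (1 + real p)) * L)"
    using has_natural_density_sieved_finite[of T P] assms by (auto simp: has_prod_over_def)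
next
  case False
  let ?c = "6 / pi\<^sup>2 * (\<Prod>p\<in>T. 1 / (1 + real p))"
  let ?u = "\<lambda>e n. \<Prod>i<n. real (e i :: nat) / (1 + real (e i))"
  have "?c \<noteq> 0"
    using assms(4) by (auto simp: add_eq_0_iff)
  have density: "\<exists>L. ?u e \<longlonglongrightarrow> L \<and> has_natural_density (sieved T P) (?c * L)"
    if "bij_betw e UNIV P" for e
    using prod_tendsto_nonneg[of e]
      has_natural_density_sieved_infinite[OF assms(4,2,1,3) that] by blast
  obtain L where L: "has_natural_density (sieved T P) (?c * L)"
    using density[OF bij_enumerate[OF False]] by blast
  \<comment> \<open>The density does not mention an enumeration, so all enumerations give the same product.\<close>
  have "?u e \<longlonglongrightarrow> L" if e: "bij_betw e UNIV P" for e
  proof -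
    obtain L' where L': "?u e \<longlonglongrightarrow> L'" "has_natural_density (sieved T P) (?c * L')"
      using density[OF e] by blast
    have "?c * L' = ?c * L"
      by (rule has_natural_density_unique[OF L'(2) L])
    then have "L' = L"
      by (simp only: mult_left_cancel[OF \<open>?c \<noteq> 0\<close>])
    then show ?thesis using L' by simp
  qed
  then show "\<exists>L. has_prod_over (\<lambda>p. real p / (1 + real p)) P L \<and>
               has_natural_density (sieved T P) (?c * L)"
    using L False by (auto simp: has_prod_over_def)
qed

end
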